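(* Let $S$ be a nilpotent-free semiring. If $B$ is a GGP $S$-semialgebra (with respect to an amount function $A: B\to\mathrm{Id}(S)$), then $B$ is an Armendariz $S$-semialgebra (with respect to $A$). In particular, if $S$ is nilpotent-free and each minimal prime ideal of $S$ is subtractive, then $S[[X]]$, with the amount function sending $f$ to the ideal $A_f$ generated by all coefficients of $f$, is an Armendariz $S$-semialgebra.
   Context: A semiring is a set $S$ with operations $+,\cdot$ such that $(S,+,0)$ and $(S,\cdot,1)$ are commutative monoids with $1\neq 0$, multiplication distributes over addition, and $s\cdot 0=0$ for all $s$. An ideal of $S$ is a nonempty subset closed under addition and under multiplication by elements of $S$; $\mathrm{Id}(S)$ is the set of ideals. $IJ$ is the ideal of finite sums of products $xy$, $x\in I$, $y\in J$. A proper ideal $\mathfrak p$ is prime if $ab\in\mathfrak p$ implies $a\in\mathfrak p$ or $b\in\mathfrak p$. An ideal $I$ is subtractive if $a+b\in I$ and $a\in I$ imply $b\in I$. $\mathrm{Nil}(S)$ is the set of nilpotent elements of $S$. $S$ is nilpotent-free if $s^2=0$ implies $s=0$ for all $s\in S$. An $S$-semialgebra is a semiring $B$ together with a semiring morphism $\gamma: S\to B$ (preserving $+,\cdot,0,1$); write $sf=\gamma(s)f$. An amount function is a function $A: B\to \mathrm{Id}(S)$, $f\mapsto A_f$, such that for all $s\in S$, $f,g\in B$: (1) $A_0=(0)$ and $A_1=S$; (2) $A_f=(0)$ implies $f=0$; (3) $A_{sf}=sA_f$; (4) $A_{fg}\subseteq A_fA_g$. With respect to an amount function $A$, $B$ is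 a GGP (Gilmer–Grams–Parker) $S$-semialgebra if $fg=0$ implies $A_fA_g\subseteq\mathrm{Nil}(S)$ for all $f,g\in B$; $B$ is an Armendariz $S$-semialgebra if $fg=0$ implies $A_fA_g=(0)$ for all $f,g\in B$. *)

theory Defs
  imports "HOL-Computational_Algebra.Formal_Power_Series"
begin

text \<open>
  Semirings are types of class \<open>comm_semiring_1\<close>: both operations are commutative,
  \<open>0\<close> is absorbing and \<open>0 \<noteq> 1\<close>.
\<close>

definition semiring_ideal :: "'s::comm_semiring_1 set \<Rightarrow> bool" where
  "semiring_ideal I \<longleftrightarrow>
     I \<noteq> {} \<and> (\<forall>a\<in>I. \<forall>b\<in>I. a + b \<in> I) \<and> (\<forall>s. \<forall>a\<in>I. s * a \<in> I)"

definition ideal_generated :: "'s::comm_semiring_1 set \<Rightarrow> 's set" where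
  "ideal_generated X = \<Inter>{I. semiring_ideal I \<and> X \<subseteq> I}"

definition ideal_prod :: "'s::comm_semiring_1 set \<Rightarrow> 's set \<Rightarrow> 's set" where
  "ideal_prod I J = {\<Sum>k<n. x k * y k | (n::nat) x y. \<forall>k<n. x k \<in> I \<and> y k \<in> J}"

definition semiring_prime_ideal :: "'s::comm_semiring_1 set \<Rightarrow> bool" where
  "semiring_prime_ideal P \<longleftrightarrow>
     semiring_ideal P \<and> P \<noteq> UNIV \<and> (\<forall>a b. a * b \<in> P \<longrightarrow> a \<in> P \<or> b \<in> P)"

definition minimal_prime_ideal :: "'s::comm_semiring_1 set \<Rightarrow> bool" where
  "minimal_prime_ideal P \<longleftrightarrow>
     semiring_prime_ideal P \<and> (\<forall>Q. semiring_prime_ideal Q \<and> Q \<subseteq> P \<longrightarrow> Q = P)"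

definition subtractive_ideal :: "'s::comm_semiring_1 set \<Rightarrow> bool" where
  "subtractive_ideal I \<longleftrightarrow>
     semiring_ideal I \<and> (\<forall>a b. a + b \<in> I \<and> a \<in> I \<longrightarrow> b \<in> I)"

definition nilpotents :: "'s::comm_semiring_1 set" where
  "nilpotents = {s. \<exists>n>0. s ^ n = 0}"

definition nilpotent_free :: "'s::comm_semiring_1 itself \<Rightarrow> bool" where
  "nilpotent_free _ \<longleftrightarrow> (\<forall>s::'s. s\<^sup>2 = 0 \<longrightarrow> s = 0)"

text \<open>An \<open>S\<close>-semialgebra is given by its structure morphism \<open>\<gamma>\<close>.\<close>

definition semialgebra :: "('s::comm_semiring_1 \<Rightarrow> 'b::comm_semiring_1) \<Rightarrow> bool" where
  "semialgebra \<gamma> \<longleftrightarrow>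
     \<gamma> 0 = 0 \<and> \<gamma> 1 = 1 \<and> (\<forall>s t. \<gamma> (s + t) = \<gamma> s + \<gamma> t) \<and> (\<forall>s t. \<gamma> (s * t) = \<gamma> s * \<gamma> t)"

definition amount_function ::
    "('s::comm_semiring_1 \<Rightarrow> 'b::comm_semiring_1) \<Rightarrow> ('b \<Rightarrow> 's set) \<Rightarrow> bool" where
  "amount_function \<gamma> A \<longleftrightarrow>
     (\<forall>f. semiring_ideal (A f)) \<and>
     A 0 = {0} \<and> A 1 = UNIV \<and>
     (\<forall>f. A f = {0} \<longrightarrow> f = 0) \<and>
     (\<forall>s f. A (\<gamma> s * f) = (\<lambda>a. s * a) ` A f) \<and>
     (\<forall>f g. A (f * g) \<subseteq> ideal_prod (A f) (A g))"

definition GGP_semialgebra ::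
    "('s::comm_semiring_1 \<Rightarrow> 'b::comm_semiring_1) \<Rightarrow> ('b \<Rightarrow> 's set) \<Rightarrow> bool" where
  "GGP_semialgebra \<gamma> A \<longleftrightarrow>
     semialgebra \<gamma> \<and> amount_function \<gamma> A \<and>
     (\<forall>f g. f * g = 0 \<longrightarrow> ideal_prod (A f) (A g) \<subseteq> nilpotents)"

definition Armendariz_semialgebra ::
    "('s::comm_semiring_1 \<Rightarrow> 'b::comm_semiring_1) \<Rightarrow> ('b \<Rightarrow> 's set) \<Rightarrow> bool" where
  "Armendariz_semialgebra \<gamma> A \<longleftrightarrow>
     semialgebra \<gamma> \<and> amount_function \<gamma> A \<and>
     (\<forall>f g. f * g = 0 \<longrightarrow> ideal_prod (A f) (A g) = {0})"

definition fps_content :: "'s::comm_semiring_1 fps \<Rightarrow> 's set" where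
  "fps_content f = ideal_generated (range (fps_nth f))"

end

theory Submission
  imports Defs
begin

text \<open>
  The power series claim is a special case of the semialgebra claim, because \<open>S[[X]]\<close> is a GGP
  semialgebra as soon as the minimal primes of \<open>S\<close> are subtractive. Indeed, let \<open>P\<close> be a
  subtractive prime and let \<open>i\<close>, \<open>j\<close> be the least indices with \<open>f\<^sub>i \<notin> P\<close> and \<open>g\<^sub>j \<notin> P\<close>. In the
  coefficient of \<open>X\<^bsup>i+j\<^esup>\<close> in \<open>f g\<close> every summand other than \<open>f\<^sub>i g\<^sub>j\<close> lies in \<open>P\<close>, whereas \<open>f\<^sub>i g\<^sub>j\<close>
  does not, so neither does the coefficient. Hence \<open>f g = 0\<close> forces \<open>A\<^sub>f \<subseteq> P\<close> or \<open>A\<^sub>g \<subseteq> P\<close>, and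
  \<open>A\<^sub>f A\<^sub>g\<close> lies in the intersection of the minimal primes, which consists of the nilpotents.
\<close>

section \<open>Ideals and their products\<close>

lemma semiring_idealI:
  assumes "0 \<in> I" "\<And>a b. a \<in> I \<Longrightarrow> b \<in> I \<Longrightarrow> a + b \<in> I" "\<And>s a. a \<in> I \<Longrightarrow> s * a \<in> I"
  shows "semiring_ideal I"
  using assms unfolding semiring_ideal_def by blast

lemma semiring_ideal_add: "semiring_ideal I \<Longrightarrow> a \<in> I \<Longrightarrow> b \<in> I \<Longrightarrow> a + b \<in> I"
  by (simp add: semiring_ideal_def)

lemma semiring_ideal_mult_left: "semiring_ideal I \<Longrightarrow> a \<in> I \<Longrightarrow> s * a \<in> I"
  by (simp add: semiring_ideal_def)

lemma semiring_ideal_mult_right: "semiring_ideal I \<Longrightarrow> a \<in> I \<Longrightarrow> a * s \<in> I"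
  by (subst mult.commute) (rule semiring_ideal_mult_left)

lemma semiring_ideal_zero:
  assumes "semiring_ideal I"
  shows "0 \<in> I"
proof -
  obtain a where "a \<in> I" using assms by (auto simp: semiring_ideal_def)
  then show ?thesis using semiring_ideal_mult_left[OF assms, of a 0] by simp
qed

lemma semiring_ideal_one_iff:
  assumes "semiring_ideal I"
  shows "1 \<in> I \<longleftrightarrow> I = UNIV"
  using semiring_ideal_mult_left[OF assms, of 1] by auto

lemma semiring_ideal_sum:
  assumes "semiring_ideal I" and "\<And>k. k \<in> K \<Longrightarrow> h k \<in> I"
  shows "sum h K \<in> I"
  using assms(2)
  by (induction K rule: infinite_finite_induct)
    (simp_all add: semiring_ideal_zero semiring_ideal_add assms(1))

lemma semiring_ideal_singleton_zero: "semiring_ideal {0}"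
  by (simp add: semiring_ideal_def)

lemma semiring_ideal_Inter: "(\<And>I. I \<in> C \<Longrightarrow> semiring_ideal I) \<Longrightarrow> semiring_ideal (\<Inter>C)"
  by (rule semiring_idealI)
    (auto intro: semiring_ideal_zero semiring_ideal_add semiring_ideal_mult_left)

lemma semiring_ideal_Union_chain:
  assumes "C \<noteq> {}" and "subset.chain {I. semiring_ideal I} C"
  shows "semiring_ideal (\<Union>C)"
proof (rule semiring_idealI)
  have ideal: "semiring_ideal I" if "I \<in> C" for I
    using assms(2) that by (auto simp: subset_chain_def)
  show "0 \<in> \<Union>C" using assms(1) semiring_ideal_zero[OF ideal] by blast
  show "s * a \<in> \<Union>C" if "a \<in> \<Union>C" for s a
    using that semiring_ideal_mult_left[OF ideal] by blast
  show "a + b \<in> \<Union>C" if "a \<in> \<Union>C" "b \<in> \<Union>C" for a b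
  proof -
    from that obtain I where "I \<in> C" "a \<in> I" "b \<in> I"
      using assms(2) unfolding subset_chain_def by blast
    then show ?thesis using semiring_ideal_add[OF ideal] by blast
  qed
qed

lemma semiring_ideal_vimage_mult:
  assumes "semiring_ideal I"
  shows "semiring_ideal ((*) s -` I)"
  by (rule semiring_idealI)
    (simp_all add: semiring_ideal_zero semiring_ideal_add semiring_ideal_mult_left assms
      distrib_left mult.left_commute[of s])

lemma semiring_ideal_image_mult:
  assumes "semiring_ideal I"
  shows "semiring_ideal ((*) s ` I)"
proof (rule semiring_idealI)
  show "0 \<in> (*) s ` I"
    using semiring_ideal_zero[OF assms] by (intro image_eqI[of _ _ 0]) simp_all
next
  fix x y assume "x \<in> (*) s ` I" "y \<in> (*) s ` I"
  then show "x + y \<in> (*) s ` I"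
    using semiring_ideal_add[OF assms] by (auto simp flip: distrib_left)
next
  fix t x assume "x \<in> (*) s ` I"
  then obtain a where "x = s * a" "a \<in> I" by blast
  then have "t * x = s * (t * a)" "t * a \<in> I"
    by (simp_all add: mult.left_commute semiring_ideal_mult_left assms)
  then show "t * x \<in> (*) s ` I" by blast
qed

lemma ideal_generated_eq_hull: "ideal_generated X = semiring_ideal hull X"
  by (simp add: ideal_generated_def hull_def)

lemma semiring_ideal_ideal_generated: "semiring_ideal (ideal_generated X)"
  unfolding ideal_generated_eq_hull
  by (rule hull_in[of semiring_ideal], rule semiring_ideal_Inter) blast

lemma ideal_generated_subset_iff: "semiring_ideal I \<Longrightarrow> ideal_generated X \<subseteq> I \<longleftrightarrow> X \<subseteq> I"
  unfolding ideal_generated_eq_hull by (rule subset_hull)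

lemma ideal_generated_image_mult: "ideal_generated ((*) s ` X) = (*) s ` ideal_generated X"
  unfolding ideal_generated_eq_hull
proof (rule hull_unique)
  show "(*) s ` X \<subseteq> (*) s ` (semiring_ideal hull X)"
    by (intro image_mono hull_subset)
  show "semiring_ideal ((*) s ` (semiring_ideal hull X))"
    using semiring_ideal_ideal_generated
    by (intro semiring_ideal_image_mult) (simp add: ideal_generated_eq_hull)
next
  fix I assume "(*) s ` X \<subseteq> I" "semiring_ideal I"
  then show "(*) s ` (semiring_ideal hull X) \<subseteq> I"
    unfolding image_subset_iff_subset_vimage
    by (intro hull_minimal semiring_ideal_vimage_mult)
qed

lemma ideal_generated_insert:
  assumes "semiring_ideal I"
  shows "ideal_generated (insert a I) = {i + s * a | i s. i \<in> I}" (is "_ = ?J")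
  unfolding ideal_generated_eq_hull
proof (rule hull_unique)
  have "i \<in> ?J" if "i \<in> I" for i
    using that by (force intro: exI[of _ 0])
  moreover have "a \<in> ?J"
    using semiring_ideal_zero[OF assms] by (force intro: exI[of _ 1])
  ultimately show "insert a I \<subseteq> ?J" by blast
  show "semiring_ideal ?J"
  proof (rule semiring_idealI)
    show "0 \<in> ?J" using \<open>insert a I \<subseteq> ?J\<close> semiring_ideal_zero[OF assms] by blast
  next
    fix x y assume "x \<in> ?J" "y \<in> ?J"
    then obtain i s j t where "x = i + s * a" "y = j + t * a" "i \<in> I" "j \<in> I" by blast
    then have "x + y = (i + j) + (s + t) * a" "i + j \<in> I"
      by (simp_all add: algebra_simps semiring_ideal_add assms)
    then show "x + y \<in> ?J" by blast
  next
    fix r x assume "x \<in> ?J"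
    then obtain i s where "x = i + s * a" "i \<in> I" by blast
    then have "r * x = r * i + (r * s) * a" "r * i \<in> I"
      by (simp_all add: distrib_left mult.assoc semiring_ideal_mult_left assms)
    then show "r * x \<in> ?J" by blast
  qed
next
  fix K assume "insert a I \<subseteq> K" "semiring_ideal K"
  then show "?J \<subseteq> K" by (auto intro: semiring_ideal_add semiring_ideal_mult_left)
qed

lemma ideal_prod_zero: "0 \<in> ideal_prod I J"
  unfolding ideal_prod_def by (auto intro!: exI[of _ "0::nat"])

lemma ideal_prod_add_mult:
  assumes "p \<in> ideal_prod I J" "a \<in> I" "b \<in> J"
  shows "p + a * b \<in> ideal_prod I J"
proof -
  obtain n :: nat and x y where
    p_eq: "p = (\<Sum>k<n. x k * y k)" and factors: "\<forall>k<n. x k \<in> I \<and> y k \<in> J"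
    using assms(1) by (auto simp: ideal_prod_def)
  have "p + a * b = (\<Sum>k<Suc n. (x(n := a)) k * (y(n := b)) k)"
    by (simp add: p_eq)
  moreover have "\<forall>k<Suc n. (x(n := a)) k \<in> I \<and> (y(n := b)) k \<in> J"
    using assms factors by (auto simp: less_Suc_eq)
  ultimately show ?thesis unfolding ideal_prod_def by blast
qed

lemma ideal_prod_mult: "a \<in> I \<Longrightarrow> b \<in> J \<Longrightarrow> a * b \<in> ideal_prod I J"
  using ideal_prod_add_mult[OF ideal_prod_zero] by force

lemma ideal_prod_induct [consumes 1, case_names zero add_mult]:
  assumes "p \<in> ideal_prod I J"
    and zero: "Q 0"
    and add_mult: "\<And>p a b. Q p \<Longrightarrow> a \<in> I \<Longrightarrow> b \<in> J \<Longrightarrow> Q (p + a * b)"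
  shows "Q p"
proof -
  obtain n :: nat and x y where
    p_eq: "p = (\<Sum>k<n. x k * y k)" and factors: "\<forall>k<n. x k \<in> I \<and> y k \<in> J"
    using assms(1) by (auto simp: ideal_prod_def)
  have "Q (\<Sum>k<m. x k * y k)" if "m \<le> n" for m
    using that
  proof (induction m)
    case 0
    show ?case by (simp add: zero)
  next
    case (Suc m)
    then show ?case using factors by (simp add: add_mult)
  qed
  then show ?thesis using p_eq by blast
qed

lemma semiring_ideal_ideal_prod:
  assumes "semiring_ideal I"
  shows "semiring_ideal (ideal_prod I J)"
proof (rule semiring_idealI)
  fix p q assume "q \<in> ideal_prod I J" "p \<in> ideal_prod I J"
  then show "p + q \<in> ideal_prod I J"
    by (induction rule: ideal_prod_induct) (simp_all add: ideal_prod_add_mult flip: add.assoc)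
next
  fix s p assume "p \<in> ideal_prod I J"
  then show "s * p \<in> ideal_prod I J"
    by (induction rule: ideal_prod_induct)
      (simp_all add: distrib_left ideal_prod_zero ideal_prod_add_mult semiring_ideal_mult_left
        assms flip: mult.assoc)
qed (rule ideal_prod_zero)

lemma ideal_prod_subset:
  assumes "semiring_ideal K" and "\<And>a b. a \<in> I \<Longrightarrow> b \<in> J \<Longrightarrow> a * b \<in> K"
  shows "ideal_prod I J \<subseteq> K"
proof
  fix p assume "p \<in> ideal_prod I J"
  then show "p \<in> K"
    by (induction rule: ideal_prod_induct)
      (simp_all add: semiring_ideal_zero semiring_ideal_add assms)
qed

section \<open>Prime ideals\<close>

lemma semiring_prime_ideal_ideal: "semiring_prime_ideal P \<Longrightarrow> semiring_ideal P"
  by (simp add: semiring_prime_ideal_def)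

lemma semiring_prime_ideal_mult_iff:
  assumes "semiring_prime_ideal P"
  shows "a * b \<in> P \<longleftrightarrow> a \<in> P \<or> b \<in> P"
  using assms semiring_ideal_mult_left semiring_ideal_mult_right
  unfolding semiring_prime_ideal_def by blast

lemma semiring_prime_ideal_one: "semiring_prime_ideal P \<Longrightarrow> 1 \<notin> P"
  using semiring_ideal_one_iff by (auto simp: semiring_prime_ideal_def)

lemma semiring_prime_ideal_power:
  assumes "semiring_prime_ideal P" and "a ^ n \<in> P"
  shows "a \<in> P"
  using assms(2)
  by (induction n)
    (auto simp: semiring_prime_ideal_one[OF assms(1)] semiring_prime_ideal_mult_iff[OF assms(1)])

lemma semiring_prime_ideal_Inter_chain:
  assumes "C \<noteq> {}" and "subset.chain {P. semiring_prime_ideal P} C"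
  shows "semiring_prime_ideal (\<Inter>C)"
  unfolding semiring_prime_ideal_def
proof (intro conjI allI impI)
  have prime: "semiring_prime_ideal P" if "P \<in> C" for P
    using assms(2) that by (auto simp: subset_chain_def)
  show "semiring_ideal (\<Inter>C)"
    by (intro semiring_ideal_Inter semiring_prime_ideal_ideal prime)
  show "\<Inter>C \<noteq> UNIV"
    using \<open>C \<noteq> {}\<close> semiring_prime_ideal_one[OF prime] by blast
  show "a \<in> \<Inter>C \<or> b \<in> \<Inter>C" if "a * b \<in> \<Inter>C" for a b
  proof (rule ccontr)
    assume "\<not> ?thesis"
    then obtain P where "P \<in> C" "a \<notin> P" "b \<notin> P"
      using assms(2) unfolding subset_chain_def by blast
    then show False using that semiring_prime_ideal_mult_iff[OF prime] by blast
  qed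
qed

lemma semiring_prime_ideal_if_maximal_disjoint:
  assumes ideal: "semiring_ideal P" and disjoint: "P \<inter> M = {}" and "M \<noteq> {}"
    and mult: "\<And>x y. x \<in> M \<Longrightarrow> y \<in> M \<Longrightarrow> x * y \<in> M"
    and maximal: "\<And>J. semiring_ideal J \<Longrightarrow> J \<inter> M = {} \<Longrightarrow> P \<subseteq> J \<Longrightarrow> J = P"
  shows "semiring_prime_ideal P"
  unfolding semiring_prime_ideal_def
proof (intro conjI allI impI)
  show "semiring_ideal P" "P \<noteq> UNIV" using assms(1-3) by auto
next
  have meets: "\<exists>i s. i \<in> P \<and> i + s * a \<in> M" if "a \<notin> P" for a
  proof -
    let ?J = "ideal_generated (insert a P)"
    have "insert a P \<subseteq> ?J" unfolding ideal_generated_eq_hull by (rule hull_subset)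
    then have "?J \<inter> M \<noteq> {}"
      using maximal[OF semiring_ideal_ideal_generated] \<open>a \<notin> P\<close> by blast
    then show ?thesis by (auto simp: ideal_generated_insert[OF ideal])
  qed
  fix a b assume ab: "a * b \<in> P"
  show "a \<in> P \<or> b \<in> P"
  proof (rule ccontr)
    assume "\<not> ?thesis"
    then obtain i s j t where
      "i \<in> P" "j \<in> P" and in_M: "i + s * a \<in> M" "j + t * b \<in> M"
      using meets by meson
    have "(i + s * a) * (j + t * b) = i * (j + t * b) + (s * a) * j + (s * t) * (a * b)"
      by (simp add: algebra_simps)
    also have "\<dots> \<in> P"
      by (intro semiring_ideal_add semiring_ideal_mult_left[of P j] semiring_ideal_mult_right
          semiring_ideal_mult_left[of P "a * b"] ideal \<open>i \<in> P\<close> \<open>j \<in> P\<close> ab)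
    finally show False using mult[OF in_M] disjoint by blast
  qed
qed

lemma exists_prime_ideal_disjoint:
  assumes "semiring_ideal I" "I \<inter> M = {}" "M \<noteq> {}"
    and mult: "\<And>x y. x \<in> M \<Longrightarrow> y \<in> M \<Longrightarrow> x * y \<in> M"
  obtains P where "semiring_prime_ideal P" "I \<subseteq> P" "P \<inter> M = {}"
proof -
  let ?F = "{J. semiring_ideal J \<and> I \<subseteq> J \<and> J \<inter> M = {}}"
  have "\<Union>C \<in> ?F" if "C \<noteq> {}" "subset.chain ?F C" for C
  proof -
    have "C \<subseteq> ?F" and "subset.chain {J. semiring_ideal J} C"
      using that(2) by (auto simp: subset_chain_def)
    then have "semiring_ideal (\<Union>C)"
      using \<open>C \<noteq> {}\<close> by (intro semiring_ideal_Union_chain)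
    then show ?thesis using \<open>C \<noteq> {}\<close> \<open>C \<subseteq> ?F\<close> by blast
  qed
  moreover have "?F \<noteq> {}" using assms(1,2) by blast
  ultimately obtain P where "P \<in> ?F" and maximal: "\<forall>J\<in>?F. P \<subseteq> J \<longrightarrow> J = P"
    using subset_Zorn_nonempty[of ?F] by blast
  have "semiring_prime_ideal P"
  proof (rule semiring_prime_ideal_if_maximal_disjoint[OF _ _ \<open>M \<noteq> {}\<close> mult])
    show "semiring_ideal P" "P \<inter> M = {}" using \<open>P \<in> ?F\<close> by blast+
    show "J = P" if "semiring_ideal J" "J \<inter> M = {}" "P \<subseteq> J" for J
      using that \<open>P \<in> ?F\<close> by (intro maximal[rule_format]) auto
  qed
  then show thesis using that \<open>P \<in> ?F\<close> by blast
qed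

lemma subset_Zorn_nonempty_minimal:
  assumes "\<A> \<noteq> {}" and Inter: "\<And>C. C \<noteq> {} \<Longrightarrow> subset.chain \<A> C \<Longrightarrow> \<Inter>C \<in> \<A>"
  shows "\<exists>M\<in>\<A>. \<forall>X\<in>\<A>. X \<subseteq> M \<longrightarrow> X = M"
proof -
  have "\<Union>C \<in> uminus ` \<A>" if "C \<noteq> {}" "subset.chain (uminus ` \<A>) C" for C
  proof -
    have "subset.chain \<A> (uminus ` C)"
      using that(2) by (auto simp: subset_chain_def)
    then have "\<Inter>(uminus ` C) \<in> \<A>"
      using that(1) by (intro Inter) simp_all
    moreover have "\<Union>C = - \<Inter>(uminus ` C)" by auto
    ultimately show ?thesis by blast
  qed
  then obtain N where "N \<in> uminus ` \<A>" "\<forall>X\<in>uminus ` \<A>. N \<subseteq> X \<longrightarrow> X = N"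
    using subset_Zorn_nonempty[of "uminus ` \<A>"] assms(1) by blast
  then show ?thesis by auto
qed

lemma exists_minimal_prime_ideal_subset:
  assumes "semiring_prime_ideal Q"
  obtains P where "minimal_prime_ideal P" "P \<subseteq> Q"
proof -
  let ?F = "{P. semiring_prime_ideal P \<and> P \<subseteq> Q}"
  have "\<Inter>C \<in> ?F" if "C \<noteq> {}" "subset.chain ?F C" for C
  proof -
    have "C \<subseteq> ?F" and "subset.chain {P. semiring_prime_ideal P} C"
      using that(2) by (auto simp: subset_chain_def)
    then have "semiring_prime_ideal (\<Inter>C)"
      using \<open>C \<noteq> {}\<close> by (intro semiring_prime_ideal_Inter_chain)
    then show ?thesis using \<open>C \<noteq> {}\<close> \<open>C \<subseteq> ?F\<close> by blast
  qed
  moreover have "Q \<in> ?F" using assms by blast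
  ultimately obtain P where "P \<in> ?F" "\<forall>P'\<in>?F. P' \<subseteq> P \<longrightarrow> P' = P"
    using subset_Zorn_nonempty_minimal[of ?F] by blast
  then show thesis
    by (intro that[of P]) (auto simp: minimal_prime_ideal_def)
qed

theorem nilpotents_eq_Inter_minimal_prime_ideals:
  "(nilpotents :: 'a::comm_semiring_1 set) = \<Inter>{P. minimal_prime_ideal P}"
proof
  have "a \<in> P" if "a \<in> nilpotents" "minimal_prime_ideal P" for a :: 'a and P
  proof -
    from that obtain n where "a ^ n = 0" and prime: "semiring_prime_ideal P"
      by (auto simp: nilpotents_def minimal_prime_ideal_def)
    then have "a ^ n \<in> P" by (simp add: semiring_ideal_zero semiring_prime_ideal_ideal)
    then show "a \<in> P" by (rule semiring_prime_ideal_power[OF prime])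
  qed
  then show "(nilpotents :: 'a set) \<subseteq> \<Inter>{P. minimal_prime_ideal P}" by blast
next
  show "\<Inter>{P. minimal_prime_ideal P} \<subseteq> (nilpotents :: 'a set)"
  proof (rule ccontr)
    assume "\<not> ?thesis"
    then obtain a :: 'a where
      a_in_minimal: "\<And>P. minimal_prime_ideal P \<Longrightarrow> a \<in> P" and "a \<notin> nilpotents" by blast
    have "a ^ n \<noteq> 0" for n
      using \<open>a \<notin> nilpotents\<close> unfolding nilpotents_def by (cases "0 < n") (blast, simp)
    then have "{0} \<inter> range ((^) a) = {}" by force
    then obtain Q where "semiring_prime_ideal Q" "Q \<inter> range ((^) a) = {}"
      by (rule exists_prime_ideal_disjoint[OF semiring_ideal_singleton_zero])
        (auto simp flip: power_add)
    moreover obtain P where "minimal_prime_ideal P" "P \<subseteq> Q"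
      using exists_minimal_prime_ideal_subset \<open>semiring_prime_ideal Q\<close> by blast
    moreover have "a ^ 1 \<in> P" using a_in_minimal \<open>minimal_prime_ideal P\<close> by simp
    ultimately show False by blast
  qed
qed

section \<open>The content of a power series\<close>

lemma semiring_ideal_fps_content: "semiring_ideal (fps_content f)"
  by (simp add: fps_content_def semiring_ideal_ideal_generated)

lemma fps_content_subset_iff:
  assumes "semiring_ideal I"
  shows "fps_content f \<subseteq> I \<longleftrightarrow> (\<forall>n. fps_nth f n \<in> I)"
  by (auto simp: fps_content_def ideal_generated_subset_iff[OF assms])

lemma fps_nth_in_fps_content: "fps_nth f n \<in> fps_content f"
  using fps_content_subset_iff[OF semiring_ideal_fps_content] by blast

lemma fps_content_eq_zero_iff: "fps_content f = {0} \<longleftrightarrow> f = 0"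
proof -
  have "fps_content f = {0} \<longleftrightarrow> fps_content f \<subseteq> {0}"
    using semiring_ideal_zero[OF semiring_ideal_fps_content] by blast
  also have "\<dots> \<longleftrightarrow> f = 0"
    by (simp add: fps_content_subset_iff[OF semiring_ideal_singleton_zero] fps_eq_iff)
  finally show ?thesis .
qed

lemma fps_content_one: "fps_content 1 = UNIV"
  using fps_nth_in_fps_content[of 1 0]
  by (simp flip: semiring_ideal_one_iff[OF semiring_ideal_fps_content])

lemma fps_content_const_mult: "fps_content (fps_const s * f) = (*) s ` fps_content f"
proof -
  have "range (fps_nth (fps_const s * f)) = (*) s ` range (fps_nth f)"
    by (auto simp: image_image)
  then show ?thesis by (simp add: fps_content_def ideal_generated_image_mult)
qed

lemma fps_content_mult_subset:
  "fps_content (f * g) \<subseteq> ideal_prod (fps_content f) (fps_content g)"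
proof -
  have ideal: "semiring_ideal (ideal_prod (fps_content f) (fps_content g))"
    by (intro semiring_ideal_ideal_prod semiring_ideal_fps_content)
  then show ?thesis
    by (auto simp: fps_content_subset_iff[OF ideal] fps_mult_nth
        intro!: semiring_ideal_sum ideal_prod_mult fps_nth_in_fps_content)
qed

lemma semialgebra_fps_const: "semialgebra fps_const"
  by (simp add: semialgebra_def)

lemma amount_function_fps_content: "amount_function fps_const fps_content"
  by (simp add: amount_function_def semiring_ideal_fps_content fps_content_eq_zero_iff
      fps_content_one fps_content_const_mult fps_content_mult_subset)

lemma fps_content_mult_subset_subtractive_prime:
  assumes prime: "semiring_prime_ideal P" and subtractive: "subtractive_ideal P"
    and fg: "fps_content (f * g) \<subseteq> P"
  shows "fps_content f \<subseteq> P \<or> fps_content g \<subseteq> P"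
proof (rule ccontr)
  have ideal: "semiring_ideal P" using prime by (rule semiring_prime_ideal_ideal)
  assume "\<not> ?thesis"
  then have "\<exists>i. fps_nth f i \<notin> P" "\<exists>j. fps_nth g j \<notin> P"
    by (simp_all add: fps_content_subset_iff[OF ideal])
  then obtain i j where
    notin: "fps_nth f i \<notin> P" "fps_nth g j \<notin> P" and
    below: "\<And>k. k < i \<Longrightarrow> fps_nth f k \<in> P" "\<And>k. k < j \<Longrightarrow> fps_nth g k \<in> P"
    using exists_least_iff[of "\<lambda>k. fps_nth f k \<notin> P"] exists_least_iff[of "\<lambda>k. fps_nth g k \<notin> P"]
    by blast
  define summand where "summand k = fps_nth f k * fps_nth g (i + j - k)" for k
  have "fps_nth (f * g) (i + j) = summand i + sum summand ({0..i + j} - {i})"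
    unfolding fps_mult_nth summand_def by (rule sum.remove) simp_all
  moreover have "fps_nth (f * g) (i + j) \<in> P"
    using fg fps_content_subset_iff[OF ideal] by blast
  moreover have "sum summand ({0..i + j} - {i}) \<in> P"
  proof (rule semiring_ideal_sum[OF ideal])
    fix k assume "k \<in> {0..i + j} - {i}"
    then have "k < i \<or> i + j - k < j" by auto
    then show "summand k \<in> P"
      using below by (auto simp: summand_def semiring_prime_ideal_mult_iff[OF prime])
  qed
  ultimately have "summand i \<in> P"
    using subtractive by (metis subtractive_ideal_def add.commute)
  then show False
    using notin by (simp add: summand_def semiring_prime_ideal_mult_iff[OF prime])
qed

theorem GGP_semialgebra_fps:
  assumes subtractive: "\<And>P :: 's::comm_semiring_1 set. minimal_prime_ideal P \<Longrightarrow> subtractive_ideal P"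
  shows "GGP_semialgebra (fps_const :: 's \<Rightarrow> 's fps) fps_content"
proof -
  have "ideal_prod (fps_content f) (fps_content g) \<subseteq> P"
    if "f * g = 0" and minimal: "minimal_prime_ideal P" for f g :: "'s fps" and P
  proof -
    have prime: "semiring_prime_ideal P" using minimal by (simp add: minimal_prime_ideal_def)
    then have ideal: "semiring_ideal P" by (rule semiring_prime_ideal_ideal)
    have "fps_content (f * g) \<subseteq> P"
      using \<open>f * g = 0\<close> by (simp add: fps_content_subset_iff[OF ideal] semiring_ideal_zero[OF ideal])
    then have "fps_content f \<subseteq> P \<or> fps_content g \<subseteq> P"
      by (rule fps_content_mult_subset_subtractive_prime[OF prime subtractive[OF minimal]])
    then show ?thesis
      by (intro ideal_prod_subset[OF ideal]) (auto simp: semiring_prime_ideal_mult_iff[OF prime])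
  qed
  then show ?thesis
    by (auto simp: GGP_semialgebra_def semialgebra_fps_const amount_function_fps_content
        nilpotents_eq_Inter_minimal_prime_ideals)
qed

section \<open>Nilpotent-free semirings\<close>

lemma nilpotent_free_nilpotents_eq:
  assumes "nilpotent_free TYPE('s::comm_semiring_1)"
  shows "(nilpotents :: 's set) = {0}"
proof -
  have "s = 0" if "s ^ Suc n = 0" for s :: 's and n
    using that
  proof (induction n)
    case (Suc n)
    have "(s ^ Suc n)\<^sup>2 = s ^ Suc (Suc n) * s ^ n"
      by (simp add: power2_eq_square ac_simps)
    then have "s ^ Suc n = 0" using assms Suc.prems by (simp add: nilpotent_free_def)
    then show ?case by (rule Suc.IH)
  qed simp
  then have "nilpotents \<subseteq> {0 :: 's}"
    unfolding nilpotents_def gr0_conv_Suc by blast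
  moreover have "(0 :: 's) \<in> nilpotents"
    unfolding nilpotents_def by (intro CollectI exI[of _ 1]) simp
  ultimately show ?thesis by blast
qed

theorem GGP_imp_Armendariz_semialgebra:
  fixes \<gamma> :: "'s::comm_semiring_1 \<Rightarrow> 'b::comm_semiring_1"
  assumes "nilpotent_free TYPE('s)" and "GGP_semialgebra \<gamma> A"
  shows "Armendariz_semialgebra \<gamma> A"
  using assms ideal_prod_zero
  unfolding GGP_semialgebra_def Armendariz_semialgebra_def nilpotent_free_nilpotents_eq[OF assms(1)]
  by blast

theorem corollary4p5:
  assumes "nilpotent_free TYPE('s::comm_semiring_1)"
  shows "(\<forall>(\<gamma> :: 's \<Rightarrow> 'b::comm_semiring_1) A.
            GGP_semialgebra \<gamma> A \<longrightarrow> Armendariz_semialgebra \<gamma> A) \<and>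
         ((\<forall>P :: 's set. minimal_prime_ideal P \<longrightarrow> subtractive_ideal P) \<longrightarrow>
            Armendariz_semialgebra (fps_const :: 's \<Rightarrow> 's fps) fps_content)"
proof (intro conjI allI impI)
  show "Armendariz_semialgebra \<gamma> A" if "GGP_semialgebra \<gamma> A" for \<gamma> :: "'s \<Rightarrow> 'b" and A
    using assms that by (rule GGP_imp_Armendariz_semialgebra)
next
  assume "\<forall>P :: 's set. minimal_prime_ideal P \<longrightarrow> subtractive_ideal P"
  then have "GGP_semialgebra (fps_const :: 's \<Rightarrow> 's fps) fps_content"
    by (intro GGP_semialgebra_fps) blast
  with assms show "Armendariz_semialgebra (fps_const :: 's \<Rightarrow> 's fps) fps_content"
    by (rule GGP_imp_Armendariz_semialgebra)
qed

end
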